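(* Suppose that computing each binomial coefficient of size $n$ takes time at most $T(n)$. Then there is a deterministic algorithm which, given $S=\{1,\dots,n\}$, a family $\mathcal{A}$ of $m$ $k$-subsets of $S$, the integer $r$, and the number $s=\gamma n$ of corrupted nodes, runs in time $O(k\,m\,n\,T(n))$ and outputs a set $P\subseteq S$ with $|P|=s$ such that at least $\kappa(\gamma)\,m$ of the groups $A\in\mathcal{A}$ satisfy $|A\cap P|\ge r$ (i.e. an attacking strategy corrupting at least $\kappa(\gamma)m$ groups).
   Context: $S$ is a set of $n$ nodes, members of $\mathcal{A}$ are called groups, $\mu$ is an authentication threshold and $r$ is the smallest integer strictly greater than $\mu k$. A group $A$ is corrupted by a set $P$ of corrupted nodes iff $|A\cap P|\ge r$. The number $s=\gamma n$ is assumed to be an integer, $\gamma\in(0,1)$. $\kappa(\gamma):=\Pr[\mathcal{H}(n,s,k)\ge r]$, where $\mathcal{H}(n,s,k)$ is the hypergeometric random variable counting the marked elements among $k$ elements drawn without replacement from $n$ elements of which $s$ are marked. *)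

theory Defs
  imports "HOL-Probability.Probability_Mass_Function" "HOL-Library.Multiset"
begin

section \<open>A random access machine on natural numbers\<close>

text \<open>
  Algorithms are programs of a small deterministic imperative language with scalar variables and
  arrays holding natural numbers. Each constant, variable or array access, arithmetic
  operation (addition, truncated subtraction, multiplication), comparison, connective and command
  costs one time step, irrespective of the magnitude of the numbers. The only exception is the
  computation of a binomial coefficient \<open>a choose b\<close>, which costs \<open>bt a b\<close> steps; the cost function
  \<open>bt\<close> is a parameter of the semantics.
\<close>

type_synonym vname = string

record state =
  scal :: "vname \<Rightarrow> nat"
  arr :: "vname \<Rightarrow> nat \<Rightarrow> nat"

datatype aexp =
    Const nat
  | Var vname
  | Elem vname aexp
  | Plus aexp aexp
  | Minus aexp aexp
  | Times aexp aexp
  | Binom aexp aexp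

datatype bexp =
    Less aexp aexp
  | Neg bexp
  | Conj bexp bexp

datatype com =
    Skip
  | Assign vname aexp
  | Store vname aexp aexp
  | Seq com com
  | Cond bexp com com
  | While bexp com

fun aval :: "aexp \<Rightarrow> state \<Rightarrow> nat" where
  "aval (Const c) \<sigma> = c"
| "aval (Var x) \<sigma> = scal \<sigma> x"
| "aval (Elem a e) \<sigma> = arr \<sigma> a (aval e \<sigma>)"
| "aval (Plus e1 e2) \<sigma> = aval e1 \<sigma> + aval e2 \<sigma>"
| "aval (Minus e1 e2) \<sigma> = aval e1 \<sigma> - aval e2 \<sigma>"
| "aval (Times e1 e2) \<sigma> = aval e1 \<sigma> * aval e2 \<sigma>"
| "aval (Binom e1 e2) \<sigma> = aval e1 \<sigma> choose aval e2 \<sigma>"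

fun acost :: "(nat \<Rightarrow> nat \<Rightarrow> nat) \<Rightarrow> aexp \<Rightarrow> state \<Rightarrow> nat" where
  "acost bt (Const c) \<sigma> = 1"
| "acost bt (Var x) \<sigma> = 1"
| "acost bt (Elem a e) \<sigma> = acost bt e \<sigma> + 1"
| "acost bt (Plus e1 e2) \<sigma> = acost bt e1 \<sigma> + acost bt e2 \<sigma> + 1"
| "acost bt (Minus e1 e2) \<sigma> = acost bt e1 \<sigma> + acost bt e2 \<sigma> + 1"
| "acost bt (Times e1 e2) \<sigma> = acost bt e1 \<sigma> + acost bt e2 \<sigma> + 1"
| "acost bt (Binom e1 e2) \<sigma> =
     acost bt e1 \<sigma> + acost bt e2 \<sigma> + bt (aval e1 \<sigma>) (aval e2 \<sigma>)"

fun bval :: "bexp \<Rightarrow> state \<Rightarrow> bool" where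
  "bval (Less e1 e2) \<sigma> = (aval e1 \<sigma> < aval e2 \<sigma>)"
| "bval (Neg b) \<sigma> = (\<not> bval b \<sigma>)"
| "bval (Conj b1 b2) \<sigma> = (bval b1 \<sigma> \<and> bval b2 \<sigma>)"

fun bcost :: "(nat \<Rightarrow> nat \<Rightarrow> nat) \<Rightarrow> bexp \<Rightarrow> state \<Rightarrow> nat" where
  "bcost bt (Less e1 e2) \<sigma> = acost bt e1 \<sigma> + acost bt e2 \<sigma> + 1"
| "bcost bt (Neg b) \<sigma> = bcost bt b \<sigma> + 1"
| "bcost bt (Conj b1 b2) \<sigma> = bcost bt b1 \<sigma> + bcost bt b2 \<sigma> + 1"

definition set_scal :: "vname \<Rightarrow> nat \<Rightarrow> state \<Rightarrow> state" where
  "set_scal x v \<sigma> = \<sigma>\<lparr>scal := (scal \<sigma>)(x := v)\<rparr>"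

definition set_arr :: "vname \<Rightarrow> nat \<Rightarrow> nat \<Rightarrow> state \<Rightarrow> state" where
  "set_arr a i v \<sigma> = \<sigma>\<lparr>arr := (arr \<sigma>)(a := (arr \<sigma> a)(i := v))\<rparr>"

text \<open>\<open>exec bt c \<sigma> t \<sigma>'\<close>: started in \<open>\<sigma>\<close>, the program \<open>c\<close> halts after \<open>t\<close> steps in \<open>\<sigma>'\<close>.\<close>

inductive exec :: "(nat \<Rightarrow> nat \<Rightarrow> nat) \<Rightarrow> com \<Rightarrow> state \<Rightarrow> nat \<Rightarrow> state \<Rightarrow> bool"
  for bt :: "nat \<Rightarrow> nat \<Rightarrow> nat" where
  Skip: "exec bt Skip \<sigma> 1 \<sigma>"
| Assign: "exec bt (Assign x e) \<sigma> (acost bt e \<sigma> + 1) (set_scal x (aval e \<sigma>) \<sigma>)"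
| Store: "exec bt (Store a i e) \<sigma> (acost bt i \<sigma> + acost bt e \<sigma> + 1)
            (set_arr a (aval i \<sigma>) (aval e \<sigma>) \<sigma>)"
| Seq: "exec bt c1 \<sigma> t1 \<sigma>1 \<Longrightarrow> exec bt c2 \<sigma>1 t2 \<sigma>2 \<Longrightarrow> exec bt (Seq c1 c2) \<sigma> (t1 + t2) \<sigma>2"
| CondTrue: "bval b \<sigma> \<Longrightarrow> exec bt c1 \<sigma> t \<sigma>1 \<Longrightarrow>
     exec bt (Cond b c1 c2) \<sigma> (bcost bt b \<sigma> + t + 1) \<sigma>1"
| CondFalse: "\<not> bval b \<sigma> \<Longrightarrow> exec bt c2 \<sigma> t \<sigma>1 \<Longrightarrow>
     exec bt (Cond b c1 c2) \<sigma> (bcost bt b \<sigma> + t + 1) \<sigma>1"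
| WhileFalse: "\<not> bval b \<sigma> \<Longrightarrow> exec bt (While b c) \<sigma> (bcost bt b \<sigma> + 1) \<sigma>"
| WhileTrue: "bval b \<sigma> \<Longrightarrow> exec bt c \<sigma> t1 \<sigma>1 \<Longrightarrow> exec bt (While b c) \<sigma>1 t2 \<sigma>2 \<Longrightarrow>
     exec bt (While b c) \<sigma> (bcost bt b \<sigma> + t1 + t2 + 1) \<sigma>2"

inductive_cases SkipE: "exec bt Skip \<sigma> t \<sigma>'"
inductive_cases AssignE: "exec bt (Assign x e) \<sigma> t \<sigma>'"
inductive_cases StoreE: "exec bt (Store a i e) \<sigma> t \<sigma>'"
inductive_cases SeqE: "exec bt (Seq c1 c2) \<sigma> t \<sigma>'"
inductive_cases CondE: "exec bt (Cond b c1 c2) \<sigma> t \<sigma>'"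
inductive_cases WhileE: "exec bt (While b c) \<sigma> t \<sigma>'"

lemma exec_deterministic:
  "exec bt c \<sigma> t \<sigma>' \<Longrightarrow> exec bt c \<sigma> u \<sigma>'' \<Longrightarrow> t = u \<and> \<sigma>' = \<sigma>''"
proof (induction arbitrary: u \<sigma>'' rule: exec.induct)
  case (Skip \<sigma>)
  then show ?case by (auto elim: SkipE)
next
  case (Assign x e \<sigma>)
  then show ?case by (auto elim: AssignE)
next
  case (Store a i e \<sigma>)
  then show ?case by (auto elim: StoreE)
next
  case (Seq c1 \<sigma> t1 \<sigma>1 c2 t2 \<sigma>2)
  from Seq.prems obtain t1' \<sigma>1' t2'
    where "exec bt c1 \<sigma> t1' \<sigma>1'" "exec bt c2 \<sigma>1' t2' \<sigma>''" "u = t1' + t2'"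
    by (rule SeqE) simp
  with Seq.IH show ?case by metis
next
  case (CondTrue b \<sigma> c1 t \<sigma>1 c2)
  from CondTrue.prems obtain t'
    where "exec bt c1 \<sigma> t' \<sigma>''" "u = bcost bt b \<sigma> + t' + 1"
    by (rule CondE) (use CondTrue.hyps(1) in simp_all)
  with CondTrue.IH show ?case by metis
next
  case (CondFalse b \<sigma> c2 t \<sigma>1 c1)
  from CondFalse.prems obtain t'
    where "exec bt c2 \<sigma> t' \<sigma>''" "u = bcost bt b \<sigma> + t' + 1"
    by (rule CondE) (use CondFalse.hyps(1) in simp_all)
  with CondFalse.IH show ?case by metis
next
  case (WhileFalse b \<sigma> c)
  from WhileFalse.prems show ?case by (rule WhileE) (use WhileFalse.hyps in simp_all)
next
  case (WhileTrue b \<sigma> c t1 \<sigma>1 t2 \<sigma>2)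
  from WhileTrue.prems obtain t1' \<sigma>1' t2'
    where "exec bt c \<sigma> t1' \<sigma>1'" "exec bt (While b c) \<sigma>1' t2' \<sigma>''"
      "u = bcost bt b \<sigma> + t1' + t2' + 1"
    by (rule WhileE) (use WhileTrue.hyps(1) in simp_all)
  with WhileTrue.IH show ?case by metis
qed


section \<open>Groups, corruption and the hypergeometric distribution\<close>

text \<open>Multisets, so that a group may occur in the family several times.\<close>

definition group_family :: "nat \<Rightarrow> nat \<Rightarrow> nat \<Rightarrow> nat set multiset \<Rightarrow> bool" where
  "group_family n k m \<A> \<longleftrightarrow> size \<A> = m \<and> (\<forall>A \<in># \<A>. A \<subseteq> {1..n} \<and> card A = k)"

definition corruption_threshold :: "real \<Rightarrow> nat \<Rightarrow> nat" where
  "corruption_threshold \<mu> k = (LEAST r. \<mu> * real k < real r)"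

definition corrupted :: "nat \<Rightarrow> nat set \<Rightarrow> nat set \<Rightarrow> bool" where
  "corrupted r P A \<longleftrightarrow> r \<le> card (A \<inter> P)"

text \<open>
  Number of marked elements among \<open>k\<close> elements drawn without replacement from \<open>{1..n}\<close>, where
  the elements of \<open>{1..s}\<close> are marked (meaningful for \<open>k \<le> n\<close> and \<open>s \<le> n\<close>).
\<close>

definition hypergeometric_pmf :: "nat \<Rightarrow> nat \<Rightarrow> nat \<Rightarrow> nat pmf" where
  "hypergeometric_pmf n s k =
     map_pmf (\<lambda>B. card (B \<inter> {1..s})) (pmf_of_set {B. B \<subseteq> {1..n} \<and> card B = k})"

text \<open>Only used when \<open>\<gamma> * n\<close> is a natural number, so the floor does not round.\<close>

definition kappa :: "nat \<Rightarrow> nat \<Rightarrow> nat \<Rightarrow> real \<Rightarrow> real" where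
  "kappa n k r \<gamma> = measure_pmf.prob (hypergeometric_pmf n (nat \<lfloor>\<gamma> * real n\<rfloor>) k) {r..}"


section \<open>Input and output conventions\<close>

text \<open>
  The family is passed in an array in row-major order: the cells with indices
  \<open>i * k, \<dots>, i * k + k - 1\<close> list the elements of the \<open>i\<close>-th group, in any order; the groups are
  also listed in any order. Cells beyond the first \<open>m * k\<close> are unconstrained.
\<close>

definition row :: "nat \<Rightarrow> (nat \<Rightarrow> nat) \<Rightarrow> nat \<Rightarrow> nat set" where
  "row k G i = (\<lambda>j. G (i * k + j)) ` {..<k}"

definition encodes_family :: "nat \<Rightarrow> nat \<Rightarrow> (nat \<Rightarrow> nat) \<Rightarrow> nat set multiset \<Rightarrow> bool" where
  "encodes_family k m G \<A> \<longleftrightarrow> image_mset (row k G) (mset_set {..<m}) = \<A>"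

definition input_state :: "nat \<Rightarrow> nat \<Rightarrow> nat \<Rightarrow> nat \<Rightarrow> nat \<Rightarrow> (nat \<Rightarrow> nat) \<Rightarrow> state" where
  "input_state n k m r s G =
     \<lparr>scal = (\<lambda>_. 0)(''n'' := n, ''k'' := k, ''m'' := m, ''r'' := r, ''s'' := s),
      arr = (\<lambda>_ _. 0)(''A'' := G)\<rparr>"

definition output_set :: "nat \<Rightarrow> state \<Rightarrow> nat set" where
  "output_set s \<sigma> = arr \<sigma> ''P'' ` {..<s}"

end

theory Submission
  imports Defs
begin

text \<open>
  Method of conditional expectations. The nodes are decided in the order \<open>1, \<dots>, n\<close>. Once the nodes
  up to \<open>v\<close> are decided, giving a set \<open>P\<close> of corrupted nodes with \<open>q\<close> further ones to come, the
  number of pairs of a group and a completion of \<open>P\<close> corrupting it is a sum of \<open>O(k m)\<close> products of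
  two binomial coefficients. The ratio of this number to the number \<open>n - v choose q\<close> of completions
  is the conditional expectation of the number of corrupted groups. Initially it is
  \<open>\<kappa>(\<gamma>) m\<close>, because the hypergeometric distribution is symmetric in sample size and number of
  marked elements, and as it is an average over the two choices for the next node, one of them
  does not decrease it.
\<close>

section \<open>Counting completions\<close>

definition num_completions :: "nat \<Rightarrow> nat \<Rightarrow> nat \<Rightarrow> nat \<Rightarrow> nat set \<Rightarrow> nat set \<Rightarrow> nat" where
  "num_completions n r v q P A = card {Q. Q \<subseteq> {v<..n} \<and> card Q = q \<and> corrupted r (P \<union> Q) A}"

section \<open>Subsets counted by their intersection with a group\<close>

text \<open>\<open>Q\<close> amounts to independent choices of \<open>Q \<inter> A\<close> and
  \<open>Q - A\<close>. The guard is there because for \<open>q < j\<close> truncated subtraction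
  would turn \<open>q - j\<close> into 0 and the second binomial coefficient into 1.\<close>

lemma card_subsets_with_intersection:
  assumes "finite V" "A \<subseteq> V"
  shows "card {Q. Q \<subseteq> V \<and> card Q = q \<and> card (Q \<inter> A) = j} =
    (if j \<le> q then (card A choose j) * (card (V - A) choose (q - j)) else 0)"
proof (cases "j \<le> q")
  case True
  have fin: "finite A" "finite (V - A)"
    using assms finite_subset by auto
  have card_Un: "card (X \<union> Y) = card X + card Y" if "X \<subseteq> A" "Y \<subseteq> V - A" for X Y
    using that fin by (intro card_Un_disjoint) (auto intro: finite_subset)
  have split: "card Q = card (Q \<inter> A) + card (Q - A)" if "Q \<subseteq> V" for Q
    using card_Un[of "Q \<inter> A" "Q - A"] that by (simp add: Int_Diff_Un Diff_mono)
  have "bij_betw (\<lambda>(X, Y). X \<union> Y)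
      ({X. X \<subseteq> A \<and> card X = j} \<times> {Y. Y \<subseteq> V - A \<and> card Y = q - j})
      {Q. Q \<subseteq> V \<and> card Q = q \<and> card (Q \<inter> A) = j}"
  proof (rule bij_betw_byWitness[where f' = "\<lambda>Q. (Q \<inter> A, Q - A)"], goal_cases)
    case 3
    have "(X \<union> Y) \<inter> A = X" if "X \<subseteq> A" "Y \<subseteq> V - A" for X Y
      using that by auto
    then show ?case
      using True assms(2) by (auto simp: card_Un)
  qed (use True in \<open>auto simp: split\<close>)
  then have "card {Q. Q \<subseteq> V \<and> card Q = q \<and> card (Q \<inter> A) = j} =
      card ({X. X \<subseteq> A \<and> card X = j} \<times> {Y. Y \<subseteq> V - A \<and> card Y = q - j})"
    by (simp add: bij_betw_same_card)
  then show ?thesis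
    using True fin by (simp add: card_cartesian_product n_subsets)
next
  case False
  have "card (Q \<inter> A) \<le> card Q" if "Q \<subseteq> V" for Q
    using that assms(1) by (meson card_mono finite_subset inf_le1)
  then have none: "{Q. Q \<subseteq> V \<and> card Q = q \<and> card (Q \<inter> A) = j} = {}"
    using False by fastforce
  show ?thesis
    unfolding none using False by simp
qed

text \<open>Partition by the size \<open>j\<close> of the intersection; the offset \<open>a\<close>
  will be the number of members corrupted already. The condition on \<open>j\<close> ends up inside
  the summand, which matches a loop over all \<open>j \<le> card A\<close>.\<close>

lemma card_subsets_with_large_intersection:
  assumes "finite V" "A \<subseteq> V"
  shows "card {Q. Q \<subseteq> V \<and> card Q = q \<and> r \<le> a + card (Q \<inter> A)} =
    (\<Sum>j\<le>card A. if r \<le> a + j \<and> j \<le> q then (card A choose j) * (card (V - A) choose (q - j)) else 0)"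
proof -
  have fin: "finite {Q. Q \<subseteq> V \<and> R Q}" for R
    using assms(1) by simp
  have le: "card (Q \<inter> A) \<le> card A" for Q
    using assms by (meson card_mono finite_subset inf_le2)
  have "{Q. Q \<subseteq> V \<and> card Q = q \<and> r \<le> a + card (Q \<inter> A)} =
      (\<Union>j\<in>{j. j \<le> card A \<and> r \<le> a + j}. {Q. Q \<subseteq> V \<and> card Q = q \<and> card (Q \<inter> A) = j})"
    using le by auto
  also have "card \<dots> = (\<Sum>j\<in>{j. j \<le> card A \<and> r \<le> a + j}.
      card {Q. Q \<subseteq> V \<and> card Q = q \<and> card (Q \<inter> A) = j})"
    by (intro card_UN_disjoint) (auto simp: fin)
  also have "\<dots> = (\<Sum>j\<in>{j \<in> {..card A}. r \<le> a + j}.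
      if j \<le> q then (card A choose j) * (card (V - A) choose (q - j)) else 0)"
    using card_subsets_with_intersection[OF assms] by (intro sum.cong) auto
  also have "\<dots> = (\<Sum>j\<le>card A. if r \<le> a + j then
      if j \<le> q then (card A choose j) * (card (V - A) choose (q - j)) else 0 else 0)"
    by (intro sum.inter_filter) simp
  also have "\<dots> = (\<Sum>j\<le>card A. if r \<le> a + j \<and> j \<le> q then
      (card A choose j) * (card (V - A) choose (q - j)) else 0)"
    by (intro sum.cong) auto
  finally show ?thesis .
qed

text \<open>
  The last condition only excludes vanishing terms; it keeps the arguments of the second binomial
  coefficient in the range in which its cost is bounded.
\<close>

definition completion_term :: "nat \<Rightarrow> nat \<Rightarrow> nat \<Rightarrow> nat \<Rightarrow> nat \<Rightarrow> nat \<Rightarrow> nat \<Rightarrow> nat" where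
  "completion_term n r v q a u j =
     (if r \<le> a + j \<and> j \<le> q \<and> q \<le> n - v - u + j
      then (u choose j) * ((n - v - u) choose (q - j)) else 0)"

text \<open>\<open>P\<close> lies within the first \<open>v\<close> nodes and completions lie
  beyond, so they meet \<open>A\<close> in disjoint sets. Hence a group matters only through two
  numbers, those of its corrupted and of its undecided members.\<close>

lemma num_completions_eq_sum:
  assumes "A \<subseteq> {1..n}" "P \<subseteq> {1..v}"
  shows "num_completions n r v q P A =
    (\<Sum>j\<le>card (A \<inter> {v<..n}). completion_term n r v q (card (A \<inter> P)) (card (A \<inter> {v<..n})) j)"
proof -
  let ?U = "A \<inter> {v<..n}"
  have "card (A \<inter> (P \<union> Q)) = card (A \<inter> P) + card (Q \<inter> ?U)" if "Q \<subseteq> {v<..n}" for Q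
  proof -
    have "A \<inter> (P \<union> Q) = (A \<inter> P) \<union> (Q \<inter> ?U)"
      using that by auto
    moreover have "finite P" "finite A"
      using assms finite_subset by blast+
    moreover have "(A \<inter> P) \<inter> (Q \<inter> ?U) = {}"
      using assms(2) by auto
    ultimately show ?thesis
      by (simp add: card_Un_disjoint)
  qed
  then have "num_completions n r v q P A =
      card {Q. Q \<subseteq> {v<..n} \<and> card Q = q \<and> r \<le> card (A \<inter> P) + card (Q \<inter> ?U)}"
    unfolding num_completions_def corrupted_def by (intro arg_cong[of _ _ card]) auto
  also have "card ({v<..n} - ?U) = n - v - card ?U"
    by (subst card_Diff_subset) auto
  then have "card {Q. Q \<subseteq> {v<..n} \<and> card Q = q \<and> r \<le> card (A \<inter> P) + card (Q \<inter> ?U)} =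
      (\<Sum>j\<le>card ?U. completion_term n r v q (card (A \<inter> P)) (card ?U) j)"
    by (subst card_subsets_with_large_intersection)
      (auto simp: completion_term_def intro!: sum.cong)
  finally show ?thesis .
qed

section \<open>Recursion over the nodes\<close>

text \<open>Only the empty completion is left, whatever \<open>v\<close> is. So the final total is
  the number of corrupted groups, and once \<open>q = 0\<close> advancing \<open>v\<close> changes
  nothing.\<close>

lemma num_completions_0: "num_completions n r v 0 P A = of_bool (corrupted r P A)"
proof -
  have "{Q. Q \<subseteq> {v<..n} \<and> card Q = 0 \<and> corrupted r (P \<union> Q) A} =
      (if corrupted r P A then {{}} else {})"
    by (auto simp: card_eq_0_iff dest: finite_subset)
  then show ?thesis
    unfolding num_completions_def by simp
qed

text \<open>Sort the completions by whether they contain \<open>Suc v\<close>; deleting it is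
  injective on those that do. This parallels Pascal's rule for the number of all completions, which
  is what makes the conditional expectation an average over the two choices.\<close>

lemma num_completions_Suc:
  assumes "v < n"
  shows "num_completions n r v (Suc q) P A =
    num_completions n r (Suc v) q (insert (Suc v) P) A + num_completions n r (Suc v) (Suc q) P A"
proof -
  let ?X = "{Q. Q \<subseteq> {Suc v<..n} \<and> card Q = q \<and> corrupted r (insert (Suc v) P \<union> Q) A}"
  let ?Y = "{Q. Q \<subseteq> {Suc v<..n} \<and> card Q = Suc q \<and> corrupted r (P \<union> Q) A}"
  let ?Z = "{Q. Q \<subseteq> {v<..n} \<and> card Q = Suc q \<and> corrupted r (P \<union> Q) A}"
  have ivl: "{v<..n} = insert (Suc v) {Suc v<..n}"
    using assms by auto
  have card_insert: "card (insert (Suc v) Q) = Suc (card Q)" if "Q \<subseteq> {Suc v<..n}" for Q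
    using that by (subst card_insert_disjoint) (auto intro: finite_subset)
  have "?Z = insert (Suc v) ` ?X \<union> ?Y"
  proof (intro equalityI subsetI)
    fix Q assume Q: "Q \<in> ?Z"
    show "Q \<in> insert (Suc v) ` ?X \<union> ?Y"
    proof (cases "Suc v \<in> Q")
      case True
      then have ins: "Q = insert (Suc v) (Q - {Suc v})"
        by auto
      have sub: "Q - {Suc v} \<subseteq> {Suc v<..n}"
        using Q ivl by auto
      have "card (Q - {Suc v}) = q"
        using Q True ins card_insert[OF sub] by auto
      moreover have "insert (Suc v) P \<union> (Q - {Suc v}) = P \<union> Q"
        using True by auto
      ultimately have "Q - {Suc v} \<in> ?X"
        using Q sub by simp
      then show ?thesis
        using ins by blast
    next
      case False
      then show ?thesis
        using Q ivl by auto
    qed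
  qed (auto simp: card_insert ivl)
  moreover have "inj_on (insert (Suc v)) ?X"
    by (rule inj_onI) (metis (no_types, lifting) greaterThanAtMost_iff insert_ident less_irrefl mem_Collect_eq subsetD)
  moreover have "insert (Suc v) ` ?X \<inter> ?Y = {}"
    by auto
  ultimately show ?thesis
    unfolding num_completions_def
    by (simp add: card_Un_disjoint card_image)
qed

section \<open>Symmetry of the hypergeometric distribution and the initial expectation\<close>

text \<open>Both sides count pairs of an \<open>s\<close>-set and a \<open>k\<close>-set sharing
  exactly \<open>j\<close> elements, with either set chosen first. The proof compares
  factorials.\<close>

lemma hypergeometric_symmetric:
  assumes "s \<le> n" "k \<le> n" "j \<le> s" "j \<le> k"
  shows "(n choose s) * ((s choose j) * ((n - s) choose (k - j))) =
    (n choose k) * ((k choose j) * ((n - k) choose (s - j)))"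
proof (cases "s + k \<le> n + j")
  case True
  have "n - s - (k - j) = n + j - s - k" "n - k - (s - j) = n + j - s - k"
    using assms by auto
  then have "real ((n choose s) * ((s choose j) * ((n - s) choose (k - j)))) =
      real ((n choose k) * ((k choose j) * ((n - k) choose (s - j))))"
    using assms True by (simp add: binomial_fact)
  then show ?thesis
    by linarith
next
  \<comment> \<open>No such pair fits into \<open>n\<close> elements: the last binomial coefficient
    on each side is 0.\<close>
  case False
  then show ?thesis
    using assms by (simp add: binomial_eq_0)
qed

text \<open>\<open>kappa\<close> draws a random \<open>k\<close>-set against fixed marked nodes,
  whereas here the group is fixed and the \<open>s\<close>-set varies; the symmetry exchanges these
  roles. Thus every group has the same initial probability of corruption.\<close>

lemma kappa_eq_num_completions:
  assumes "real s = \<gamma> * real n" "s \<le> n" "A \<subseteq> {1..n}" "card A = k"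
  shows "kappa n k r \<gamma> * real (n choose s) = real (num_completions n r 0 s {} A)"
proof -
  let ?B = "{B. B \<subseteq> {1..n} \<and> card B = k}"
  let ?C = "{B. B \<subseteq> {1..n} \<and> card B = k \<and> r \<le> 0 + card (B \<inter> {1..s})}"
  have "k \<le> n"
    using assms(3,4) card_mono[of "{1..n}" A] by simp
  have B: "finite ?B" "?B \<noteq> {}" "card ?B = n choose k"
    using assms(3,4) by (auto simp: n_subsets)
  have "nat \<lfloor>\<gamma> * real n\<rfloor> = s"
    unfolding assms(1)[symmetric] by simp
  moreover have "?B \<inter> (\<lambda>B. card (B \<inter> {1..s})) -` {r..} = ?C"
    by auto
  ultimately have "kappa n k r \<gamma> = real (card ?C) / real (n choose k)"
    using B by (simp add: kappa_def hypergeometric_pmf_def measure_pmf_of_set)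
  moreover have "(n choose s) * card ?C = (n choose k) * num_completions n r 0 s {} A"
  proof -
    let ?f = "\<lambda>j. if r \<le> j \<and> j \<le> k then (s choose j) * ((n - s) choose (k - j)) else 0"
    let ?g = "\<lambda>j. if r \<le> j \<and> j \<le> s then (k choose j) * ((n - k) choose (s - j)) else 0"
    \<comment> \<open>If \<open>j\<close> exceeds \<open>s\<close> or \<open>k\<close>, both sides
      vanish, through a guard or through a binomial coefficient equal to 0.\<close>
    have fg: "(n choose s) * ?f j = (n choose k) * ?g j" for j
      using hypergeometric_symmetric[OF assms(2) \<open>k \<le> n\<close>, of j] by (auto simp: not_le)
    have "card ({1..n} - {1..s}) = n - s"
      using assms(2) by (subst card_Diff_subset) auto
    then have "card ?C = (\<Sum>j\<le>s. ?f j)"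
      by (subst card_subsets_with_large_intersection) (use assms(2) in \<open>auto intro!: sum.cong\<close>)
    \<comment> \<open>Padding with zeros gives both sums the common range \<open>j \<le> n\<close>,
      so that \<open>fg\<close> applies termwise.\<close>
    also have "\<dots> = (\<Sum>j\<le>n. ?f j)"
      by (rule sum.mono_neutral_left) (use assms(2) in auto)
    finally have C: "card ?C = (\<Sum>j\<le>n. ?f j)" .
    have ivl: "{0<..n} = {1..n}"
      by auto
    have "num_completions n r 0 s {} A =
        card {Q. Q \<subseteq> {1..n} \<and> card Q = s \<and> r \<le> 0 + card (Q \<inter> A)}"
      unfolding num_completions_def corrupted_def ivl by (simp add: Int_commute)
    also have "card ({1..n} - A) = n - k"
      using assms(3,4) by (subst card_Diff_subset) (auto intro: finite_subset)
    then have "card {Q. Q \<subseteq> {1..n} \<and> card Q = s \<and> r \<le> 0 + card (Q \<inter> A)} = (\<Sum>j\<le>k. ?g j)"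
      by (subst card_subsets_with_large_intersection) (use assms(3,4) in \<open>auto intro!: sum.cong\<close>)
    also have "\<dots> = (\<Sum>j\<le>n. ?g j)"
      by (rule sum.mono_neutral_left) (use \<open>k \<le> n\<close> in auto)
    finally have N: "num_completions n r 0 s {} A = (\<Sum>j\<le>n. ?g j)" .
    show ?thesis
      unfolding C N sum_distrib_left by (intro sum.cong refl fg)
  qed
  then have "real (n choose s) * real (card ?C) = real (n choose k) * real (num_completions n r 0 s {} A)"
    by (simp only: flip: of_nat_mult)
  ultimately have "real (n choose k) * (kappa n k r \<gamma> * real (n choose s)) =
      real (n choose k) * real (num_completions n r 0 s {} A)"
  proof -
    assume frac: "kappa n k r \<gamma> = real (card ?C) / real (n choose k)"
      and swap: "real (n choose s) * real (card ?C) = real (n choose k) * real (num_completions n r 0 s {} A)"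
    have "real (n choose k) * kappa n k r \<gamma> = real (card ?C)"
      unfolding frac using \<open>k \<le> n\<close> by simp
    then show ?thesis
      unfolding swap[symmetric] by (metis mult.left_commute mult.commute)
  qed
  then show ?thesis
    using \<open>k \<le> n\<close> by simp
qed

lemma num_completions_eq_0:
  assumes "n - v < q"
  shows "num_completions n r v q P A = 0"
proof -
  have "card Q \<noteq> q" if "Q \<subseteq> {v<..n}" for Q
    using card_mono[OF _ that] assms by simp
  then have "{Q. Q \<subseteq> {v<..n} \<and> card Q = q \<and> corrupted r (P \<union> Q) A} = {}"
    by blast
  then show ?thesis
    unfolding num_completions_def by (simp only: card.empty)
qed

section \<open>Totals over the family and the averaging step\<close>

text \<open>A row of \<open>k\<close> cells with \<open>k\<close> distinct values repeats none, so
  scanning the cells counts each member once.\<close>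

lemma sum_row:
  assumes "card (row k G i) = k"
  shows "(\<Sum>j<k. of_bool (G (i * k + j) \<in> S)) = card (row k G i \<inter> S)"
proof -
  have inj: "inj_on (\<lambda>j. G (i * k + j)) {..<k}"
    using assms unfolding row_def by (intro eq_card_imp_inj_on) auto
  have "row k G i \<inter> S = (\<lambda>j. G (i * k + j)) ` {j \<in> {..<k}. G (i * k + j) \<in> S}"
    unfolding row_def by auto
  also have "card \<dots> = card {j \<in> {..<k}. G (i * k + j) \<in> S}"
    by (intro card_image inj_on_subset[OF inj]) auto
  also have "\<dots> = (\<Sum>j<k. of_bool (G (i * k + j) \<in> S))"
    by (simp add: sum_of_bool_eq Int_def)
  finally show ?thesis ..
qed

definition total_completions ::
  "nat \<Rightarrow> nat \<Rightarrow> nat \<Rightarrow> nat \<Rightarrow> (nat \<Rightarrow> nat) \<Rightarrow> nat \<Rightarrow> nat \<Rightarrow> nat set \<Rightarrow> nat" where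
  "total_completions n k m r G v q P = (\<Sum>i<m. num_completions n r v q P (row k G i))"

text \<open>The inequalities are cross-multiplied comparisons with the initial expectation
  \<open>K / M\<close>, where \<open>M\<close> will be \<open>n choose s\<close>. Pascal's rule and
  \<open>num_completions_Suc\<close> split the two sides of \<open>avg\<close>; if accepting falls
  strictly short, rejecting strictly exceeds. The total after rejection is then positive, so enough
  nodes must remain.\<close>

lemma reject_node:
  assumes "v < n"
    and avg: "K * ((n - v) choose Suc q) \<le> total_completions n k m r G v (Suc q) P * M"
    and reject: "total_completions n k m r G (Suc v) q (insert (Suc v) P) * M < K * ((n - Suc v) choose q)"
  shows "Suc q \<le> n - Suc v"
    and "K * ((n - Suc v) choose Suc q) \<le> total_completions n k m r G (Suc v) (Suc q) P * M"
proof -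
  have "n - v = Suc (n - Suc v)"
    using assms(1) by simp
  then have "K * ((n - Suc v) choose q) + K * ((n - Suc v) choose Suc q) \<le>
      total_completions n k m r G (Suc v) q (insert (Suc v) P) * M +
      total_completions n k m r G (Suc v) (Suc q) P * M"
    using avg unfolding total_completions_def num_completions_Suc[OF assms(1)]
    by (simp add: sum.distrib algebra_simps)
  then have less: "K * ((n - Suc v) choose Suc q) < total_completions n k m r G (Suc v) (Suc q) P * M"
    using reject by linarith
  show "Suc q \<le> n - Suc v"
  proof (rule ccontr)
    assume "\<not> Suc q \<le> n - Suc v"
    then have "total_completions n k m r G (Suc v) (Suc q) P = 0"
      unfolding total_completions_def by (simp add: num_completions_eq_0)
    with less show False
      by simp
  qed
  show "K * ((n - Suc v) choose Suc q) \<le> total_completions n k m r G (Suc v) (Suc q) P * M"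
    using less by simp
qed


section \<open>Weakest preconditions with running time\<close>

text \<open>The postcondition also receives the running time. Asking for some run loses nothing,
  since execution is deterministic.\<close>

definition wp :: "(nat \<Rightarrow> nat \<Rightarrow> nat) \<Rightarrow> com \<Rightarrow> (nat \<Rightarrow> state \<Rightarrow> bool) \<Rightarrow> state \<Rightarrow> bool" where
  "wp bt c Q \<sigma> \<longleftrightarrow> (\<exists>t \<sigma>'. exec bt c \<sigma> t \<sigma>' \<and> Q t \<sigma>')"

lemma wp_simps [simp]:
  "wp bt Skip Q \<sigma> \<longleftrightarrow> Q 1 \<sigma>"
  "wp bt (Assign x e) Q \<sigma> \<longleftrightarrow> Q (acost bt e \<sigma> + 1) (set_scal x (aval e \<sigma>) \<sigma>)"
  "wp bt (Store a i e) Q \<sigma> \<longleftrightarrow>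
     Q (acost bt i \<sigma> + acost bt e \<sigma> + 1) (set_arr a (aval i \<sigma>) (aval e \<sigma>) \<sigma>)"
  "wp bt (Seq c1 c2) Q \<sigma> \<longleftrightarrow> wp bt c1 (\<lambda>t1. wp bt c2 (\<lambda>t2. Q (t1 + t2))) \<sigma>"
  "wp bt (Cond b c1 c2) Q \<sigma> \<longleftrightarrow>
     (if bval b \<sigma> then wp bt c1 (\<lambda>t. Q (bcost bt b \<sigma> + t + 1)) \<sigma>
      else wp bt c2 (\<lambda>t. Q (bcost bt b \<sigma> + t + 1)) \<sigma>)"
proof -
  show "wp bt Skip Q \<sigma> \<longleftrightarrow> Q 1 \<sigma>"
    unfolding wp_def by (metis exec.Skip exec_deterministic)
  show "wp bt (Assign x e) Q \<sigma> \<longleftrightarrow> Q (acost bt e \<sigma> + 1) (set_scal x (aval e \<sigma>) \<sigma>)"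
    unfolding wp_def by (metis exec.Assign exec_deterministic)
  show "wp bt (Store a i e) Q \<sigma> \<longleftrightarrow>
      Q (acost bt i \<sigma> + acost bt e \<sigma> + 1) (set_arr a (aval i \<sigma>) (aval e \<sigma>) \<sigma>)"
    unfolding wp_def by (metis exec.Store exec_deterministic)
  show "wp bt (Seq c1 c2) Q \<sigma> \<longleftrightarrow> wp bt c1 (\<lambda>t1. wp bt c2 (\<lambda>t2. Q (t1 + t2))) \<sigma>"
    unfolding wp_def by (rule iffI) (elim exE conjE SeqE, blast, blast intro: exec.Seq)
  show "wp bt (Cond b c1 c2) Q \<sigma> \<longleftrightarrow>
      (if bval b \<sigma> then wp bt c1 (\<lambda>t. Q (bcost bt b \<sigma> + t + 1)) \<sigma>
       else wp bt c2 (\<lambda>t. Q (bcost bt b \<sigma> + t + 1)) \<sigma>)"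
  proof (rule iffI)
    show "if bval b \<sigma> then wp bt c1 (\<lambda>t. Q (bcost bt b \<sigma> + t + 1)) \<sigma>
       else wp bt c2 (\<lambda>t. Q (bcost bt b \<sigma> + t + 1)) \<sigma>" if "wp bt (Cond b c1 c2) Q \<sigma>"
      using that unfolding wp_def by (elim exE conjE CondE) auto
  qed (auto simp: wp_def simp del: One_nat_def split: if_splits intro: exec.CondTrue exec.CondFalse)
qed

lemma wp_mono: "wp bt c Q \<sigma> \<Longrightarrow> (\<And>t \<sigma>'. Q t \<sigma>' \<Longrightarrow> Q' t \<sigma>') \<Longrightarrow> wp bt c Q' \<sigma>"
  unfolding wp_def by blast

text \<open>A rule for loops whose number \<open>N\<close> of rounds is known beforehand, with an
  invariant indexed by the rounds done. \<open>B\<close> bounds the body and \<open>C\<close> one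
  test of the guard; there is one more test than there are rounds.\<close>

lemma wp_While:
  assumes "I 0 \<sigma>"
    and step: "\<And>i \<sigma>. i < N \<Longrightarrow> I i \<sigma> \<Longrightarrow> bval b \<sigma> \<and> bcost bt b \<sigma> + 1 \<le> C \<and>
      wp bt c (\<lambda>t \<sigma>'. t \<le> B \<and> I (Suc i) \<sigma>') \<sigma>"
    and stop: "\<And>\<sigma>. I N \<sigma> \<Longrightarrow> \<not> bval b \<sigma> \<and> bcost bt b \<sigma> + 1 \<le> C"
  shows "wp bt (While b c) (\<lambda>t \<sigma>'. t \<le> N * (B + C) + C \<and> I N \<sigma>') \<sigma>"
proof -
  have "wp bt (While b c) (\<lambda>t \<sigma>'. t \<le> (N - i) * (B + C) + C \<and> I N \<sigma>') \<sigma>"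
    if "i \<le> N" "I i \<sigma>" for i \<sigma>
    using that
  \<comment> \<open>Induction on the number of rounds still to come.\<close>
  proof (induction "N - i" arbitrary: i \<sigma>)
    case 0
    then have "i = N"
      by simp
    then show ?case
      using stop[of \<sigma>] 0 exec.WhileFalse[of b \<sigma> bt c] unfolding wp_def by fastforce
  next
    case (Suc d)
    then have i: "i < N"
      by simp
    from step[OF i Suc.prems(2)] obtain t1 \<sigma>1 where b: "bval b \<sigma>" "bcost bt b \<sigma> + 1 \<le> C"
      and 1: "exec bt c \<sigma> t1 \<sigma>1" "t1 \<le> B" "I (Suc i) \<sigma>1"
      unfolding wp_def by blast
    have "d = N - Suc i"
      using Suc.hyps(2) by simp
    from Suc.hyps(1)[OF this _ 1(3)] i obtain t2 \<sigma>2
      where 2: "exec bt (While b c) \<sigma>1 t2 \<sigma>2" "t2 \<le> (N - Suc i) * (B + C) + C" "I N \<sigma>2"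
      unfolding wp_def by auto
    have "N - i = Suc (N - Suc i)"
      using i by simp
    then have "bcost bt b \<sigma> + t1 + t2 + 1 \<le> (N - i) * (B + C) + C"
      using b(2) 1(2) 2(2) by simp
    then show ?case
      using exec.WhileTrue[OF b(1) 1(1) 2(1)] 2(3) unfolding wp_def by blast
  qed
  from this[of 0 \<sigma>] assms(1) show ?thesis
    by simp
qed

lemma set_state_simps [simp]:
  "scal (set_scal x w \<sigma>) y = (if y = x then w else scal \<sigma> y)"
  "arr (set_scal x w \<sigma>) = arr \<sigma>"
  "scal (set_arr a i w \<sigma>) = scal \<sigma>"
  "arr (set_arr a i w \<sigma>) b = (if b = a then (arr \<sigma> a)(i := w) else arr \<sigma> b)"
  by (simp_all add: set_scal_def set_arr_def)


section \<open>The attack program\<close>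

definition same_except :: "vname set \<Rightarrow> state \<Rightarrow> state \<Rightarrow> bool" where
  "same_except X \<sigma> \<sigma>' \<longleftrightarrow> arr \<sigma>' = arr \<sigma> \<and> (\<forall>y. y \<notin> X \<longrightarrow> scal \<sigma>' y = scal \<sigma> y)"

section \<open>Computing the total for a partial choice\<close>

text \<open>Array \<open>B\<close> will hold the characteristic function of the corrupted set, so
  adding its entries makes \<open>a\<close> count corrupted members of group \<open>i\<close>, while
  \<open>u\<close> counts its members beyond \<open>v\<close>.\<close>

definition scan_row :: com where
  "scan_row =
    Seq (Assign ''a'' (Const 0)) (Seq (Assign ''u'' (Const 0)) (Seq (Assign ''j'' (Const 0))
    (While (Less (Var ''j'') (Var ''k''))
      (Seq (Assign ''x'' (Elem ''A'' (Plus (Times (Var ''i'') (Var ''k'')) (Var ''j''))))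
      (Seq (Assign ''a'' (Plus (Var ''a'') (Elem ''B'' (Var ''x''))))
      (Seq (Cond (Less (Var ''v'') (Var ''x'')) (Assign ''u'' (Plus (Var ''u'') (Const 1))) Skip)
        (Assign ''j'' (Plus (Var ''j'') (Const 1)))))))))"

lemma wp_scan_row:
  fixes \<sigma> :: state
  defines "X \<equiv> \<lambda>j. arr \<sigma> ''A'' (scal \<sigma> ''i'' * scal \<sigma> ''k'' + j)"
  shows "wp bt scan_row (\<lambda>t \<sigma>'. t \<le> 50 * scal \<sigma> ''k'' + 50 \<and>
    same_except {''a'', ''u'', ''j'', ''x''} \<sigma> \<sigma>' \<and>
    scal \<sigma>' ''a'' = (\<Sum>j<scal \<sigma> ''k''. arr \<sigma> ''B'' (X j)) \<and>
    scal \<sigma>' ''u'' = (\<Sum>j<scal \<sigma> ''k''. of_bool (scal \<sigma> ''v'' < X j))) \<sigma>"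
proof -
  define I where "I = (\<lambda>l \<sigma>'. same_except {''a'', ''u'', ''j'', ''x''} \<sigma> \<sigma>' \<and> scal \<sigma>' ''j'' = l \<and>
    scal \<sigma>' ''a'' = (\<Sum>j<l. arr \<sigma> ''B'' (X j)) \<and>
    scal \<sigma>' ''u'' = (\<Sum>j<l. of_bool (scal \<sigma> ''v'' < X j)))"
  show ?thesis
    unfolding scan_row_def wp_simps
    \<comment> \<open>\<open>C = 4\<close> is the exact cost of one test; \<open>B = 40\<close> is a
      generous bound for the body.\<close>
    by (rule wp_mono[OF wp_While[where I = I and N = "scal \<sigma> ''k''" and B = 40 and C = 4]])
      (simp_all add: I_def same_except_def X_def del: sum_of_bool_eq)
qed

text \<open>Each \<open>\<le>\<close> becomes \<open>Less\<close> with 1 added on the right. The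
  conditions are tested before any binomial coefficient is computed.\<close>

definition sum_terms :: com where
  "sum_terms =
    Seq (Assign ''j'' (Const 0))
    (While (Less (Var ''j'') (Plus (Var ''u'') (Const 1)))
      (Seq (Cond (Conj (Less (Var ''r'') (Plus (Plus (Var ''a'') (Var ''j'')) (Const 1)))
            (Conj (Less (Var ''j'') (Plus (Var ''q'') (Const 1)))
              (Less (Var ''q'')
                (Plus (Plus (Minus (Minus (Var ''n'') (Var ''v'')) (Var ''u'')) (Var ''j'')) (Const 1)))))
          (Assign ''acc'' (Plus (Var ''acc'') (Times (Binom (Var ''u'') (Var ''j''))
            (Binom (Minus (Minus (Var ''n'') (Var ''v'')) (Var ''u'')) (Minus (Var ''q'') (Var ''j''))))))
          Skip)
        (Assign ''j'' (Plus (Var ''j'') (Const 1)))))"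

lemma wp_sum_terms:
  fixes \<sigma> :: state
  assumes bt: "\<And>a b. b \<le> a \<Longrightarrow> a \<le> scal \<sigma> ''n'' \<Longrightarrow> bt a b \<le> D"
    and u: "scal \<sigma> ''u'' \<le> scal \<sigma> ''n''"
  shows "wp bt sum_terms (\<lambda>t \<sigma>'. t \<le> (scal \<sigma> ''u'' + 1) * (2 * D + 70) + 20 \<and>
    same_except {''acc'', ''j''} \<sigma> \<sigma>' \<and>
    scal \<sigma>' ''acc'' = scal \<sigma> ''acc'' + (\<Sum>j\<le>scal \<sigma> ''u''.
      completion_term (scal \<sigma> ''n'') (scal \<sigma> ''r'') (scal \<sigma> ''v'') (scal \<sigma> ''q'')
        (scal \<sigma> ''a'') (scal \<sigma> ''u'') j)) \<sigma>"
proof -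
  define f where "f = completion_term (scal \<sigma> ''n'') (scal \<sigma> ''r'') (scal \<sigma> ''v'') (scal \<sigma> ''q'')
        (scal \<sigma> ''a'') (scal \<sigma> ''u'')"
  define I where "I = (\<lambda>l \<sigma>'. same_except {''acc'', ''j''} \<sigma> \<sigma>' \<and> scal \<sigma>' ''j'' = l \<and>
    scal \<sigma>' ''acc'' = scal \<sigma> ''acc'' + (\<Sum>j<l. f j))"
  have bt_le: "bt (scal \<sigma> ''u'') j \<le> D" if "j \<le> scal \<sigma> ''u''" for j
    using bt u that by blast
  have bt_le': "bt (scal \<sigma> ''n'' - scal \<sigma> ''v'' - scal \<sigma> ''u'') (scal \<sigma> ''q'' - j) \<le> D"
    if "scal \<sigma> ''q'' \<le> scal \<sigma> ''n'' - scal \<sigma> ''v'' - scal \<sigma> ''u'' + j" for j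
    using that by (intro bt) auto
  show ?thesis
    unfolding sum_terms_def wp_simps
  \<comment> \<open>\<open>j\<close> runs from 0 up to and including \<open>u\<close>, hence
    \<open>u + 1\<close> rounds; \<open>2 * D\<close> pays for the two binomial coefficients of a
    round.\<close>
  proof (rule wp_mono[OF wp_While[where I = I and N = "scal \<sigma> ''u'' + 1" and B = "2 * D + 60" and C = 10]],
      goal_cases)
    case (2 l \<sigma>')
    then show ?case
      using bt_le[of l] bt_le'[of l]
      by (cases "scal \<sigma> ''q'' \<le> scal \<sigma> ''n'' - scal \<sigma> ''v'' - scal \<sigma> ''u'' + l")
        (simp_all add: I_def same_except_def f_def completion_term_def less_Suc_eq_le)
  qed (simp_all add: I_def same_except_def f_def lessThan_Suc_atMost distrib_left)
qed

definition score :: com where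
  "score =
    Seq (Assign ''acc'' (Const 0)) (Seq (Assign ''i'' (Const 0))
    (While (Less (Var ''i'') (Var ''m''))
      (Seq scan_row (Seq sum_terms (Assign ''i'' (Plus (Var ''i'') (Const 1)))))))"

abbreviation score_vars :: "vname set" where
  "score_vars \<equiv> {''acc'', ''i'', ''j'', ''a'', ''u'', ''x''}"

text \<open>Each of the \<open>m\<close> groups costs one scan of \<open>k\<close> cells and at most
  \<open>k + 1\<close> terms with two binomial coefficients each, which is
  \<open>O(k D)\<close>.\<close>

lemma wp_score:
  fixes \<sigma> :: state
  assumes bt: "\<And>a b. b \<le> a \<Longrightarrow> a \<le> n \<Longrightarrow> bt a b \<le> D"
    and pos: "1 \<le> k" "1 \<le> m" "1 \<le> D"
    and rows: "\<And>i. i < m \<Longrightarrow> row k G i \<subseteq> {1..n} \<and> card (row k G i) = k"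
    and \<sigma>: "scal \<sigma> ''n'' = n" "scal \<sigma> ''k'' = k" "scal \<sigma> ''m'' = m" "scal \<sigma> ''r'' = r"
      "scal \<sigma> ''v'' = v" "scal \<sigma> ''q'' = q" "arr \<sigma> ''A'' = G" "arr \<sigma> ''B'' = (\<lambda>x. of_bool (x \<in> P))"
    and P: "P \<subseteq> {1..v}"
  shows "wp bt score (\<lambda>t \<sigma>'. t \<le> 400 * (k * m * D) \<and> same_except score_vars \<sigma> \<sigma>' \<and>
    scal \<sigma>' ''acc'' = total_completions n k m r G v q P) \<sigma>"
proof -
  have "k \<le> n"
    using rows[of 0] pos card_mono[of "{1..n}" "row k G 0"] by simp
  define I where "I = (\<lambda>l \<sigma>'. same_except score_vars \<sigma> \<sigma>' \<and> scal \<sigma>' ''i'' = l \<and>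
    scal \<sigma>' ''acc'' = (\<Sum>i<l. num_completions n r v q P (row k G i)))"
  define B where "B = 50 * k + (k + 1) * (2 * D + 70) + 80"
  have body: "wp bt (Seq scan_row (Seq sum_terms (Assign ''i'' (Plus (Var ''i'') (Const 1)))))
      (\<lambda>t \<sigma>'. t \<le> B \<and> I (Suc i) \<sigma>') \<sigma>0"
    if i: "i < m" and I: "I i \<sigma>0" for i \<sigma>0
  proof -
    let ?a = "card (row k G i \<inter> P)" and ?u = "card (row k G i \<inter> {v<..n})"
    have card: "card (row k G i) = k" and sub: "row k G i \<subseteq> {1..n}"
      using rows i by auto
    have \<sigma>0: "scal \<sigma>0 ''n'' = n" "scal \<sigma>0 ''k'' = k" "scal \<sigma>0 ''r'' = r" "scal \<sigma>0 ''v'' = v"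
        "scal \<sigma>0 ''q'' = q" "scal \<sigma>0 ''i'' = i" "arr \<sigma>0 ''A'' = G"
        "arr \<sigma>0 ''B'' = (\<lambda>x. of_bool (x \<in> P))"
      using I \<sigma> by (simp_all add: I_def same_except_def)
    have a: "(\<Sum>j<k. of_bool (G (i * k + j) \<in> P)) = ?a"
      by (rule sum_row[OF card])
    \<comment> \<open>Members never exceed \<open>n\<close>, so the program's test
      \<open>v < x\<close> alone detects undecided members.\<close>
    have "row k G i \<inter> {v<..n} = row k G i \<inter> {v<..}"
      using sub by auto
    then have u: "(\<Sum>j<k. of_bool (v < G (i * k + j))) = ?u"
      using sum_row[OF card, of "{v<..}"] by (simp only: greaterThan_iff)
    have "?u \<le> card (row k G i)"
      using sub by (intro card_mono) (auto intro: finite_subset)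
    then have "?u \<le> k"
      unfolding card .
    have terms: "wp bt (Seq sum_terms (Assign ''i'' (Plus (Var ''i'') (Const 1))))
        (\<lambda>t \<sigma>2. t \<le> (k + 1) * (2 * D + 70) + 30 \<and> I (Suc i) \<sigma>2) \<sigma>1"
      if \<sigma>1: "same_except {''a'', ''u'', ''j'', ''x''} \<sigma>0 \<sigma>1" "scal \<sigma>1 ''a'' = ?a" "scal \<sigma>1 ''u'' = ?u"
      for \<sigma>1
    proof -
      have \<sigma>1': "scal \<sigma>1 ''n'' = n" "scal \<sigma>1 ''r'' = r" "scal \<sigma>1 ''v'' = v" "scal \<sigma>1 ''q'' = q"
        using \<sigma>1(1) \<sigma>0 by (simp_all add: same_except_def)
      have "wp bt sum_terms (\<lambda>t \<sigma>'. t \<le> (?u + 1) * (2 * D + 70) + 20 \<and>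
          same_except {''acc'', ''j''} \<sigma>1 \<sigma>' \<and>
          scal \<sigma>' ''acc'' = scal \<sigma>1 ''acc'' + num_completions n r v q P (row k G i)) \<sigma>1"
        using wp_sum_terms[of \<sigma>1 bt D] bt \<sigma>1 \<sigma>1' \<open>?u \<le> k\<close> \<open>k \<le> n\<close>
        by (simp add: num_completions_eq_sum[OF sub P])
      then show ?thesis
        unfolding wp_simps
      proof (elim wp_mono conjE, intro conjI, goal_cases)
        case (1 t \<sigma>2)
        have "(?u + 1) * (2 * D + 70) \<le> (k + 1) * (2 * D + 70)"
          using \<open>?u \<le> k\<close> by (intro mult_le_mono1) simp
        moreover have "acost bt (Plus (Var ''i'') (Const 1)) \<sigma>2 = 3"
          by simp
        ultimately show ?case
          using 1(1) by linarith
      qed (use I \<sigma>1(1) in \<open>simp add: I_def same_except_def\<close>)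
    qed
    have "wp bt scan_row (\<lambda>t \<sigma>'. t \<le> 50 * k + 50 \<and>
        same_except {''a'', ''u'', ''j'', ''x''} \<sigma>0 \<sigma>' \<and> scal \<sigma>' ''a'' = ?a \<and> scal \<sigma>' ''u'' = ?u) \<sigma>0"
      using wp_scan_row[of bt \<sigma>0] unfolding \<sigma>0 a u .
    then show ?thesis
      unfolding wp_simps(4)[of bt scan_row]
    proof (elim wp_mono conjE, goal_cases)
      case (1 t \<sigma>1)
      show ?case
        by (rule wp_mono[OF terms]) (use 1 in \<open>simp_all add: B_def\<close>)
    qed
  qed
  \<comment> \<open>As \<open>k\<close>, \<open>m\<close> and \<open>D\<close> are at least 1, all
    lower-order terms are absorbed into multiples of \<open>k * m * D\<close>. The extra 10 covers
    the final test and the two initial assignments.\<close>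
  have "k * 1 \<le> k * D" "1 * D \<le> k * D" "1 * 1 \<le> k * D"
    using pos by (intro mult_le_mono; simp)+
  moreover have "(k + 1) * (2 * D + 70) = 2 * (k * D) + 70 * k + 2 * D + 70"
    by (simp add: algebra_simps)
  ultimately have "B + 10 \<le> 390 * (k * D)"
    unfolding B_def by linarith
  then have "m * (B + 10) \<le> m * (390 * (k * D))"
    by (rule mult_le_mono2)
  moreover have "m * (390 * (k * D)) = 390 * (k * m * D)" "m * (B + 10) = m * (B + 4) + 6 * m"
    by (simp_all add: algebra_simps)
  moreover have "1 * 1 * 1 \<le> k * m * D"
    using pos by (intro mult_le_mono)
  ultimately have bound: "m * (B + 4) + 10 \<le> 400 * (k * m * D)"
    by linarith
  show ?thesis
    unfolding score_def wp_simps(2) wp_simps(4)[of bt "Assign _ _"]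
  proof (rule wp_mono[OF wp_While[where I = I and N = m and B = B and C = 4]], goal_cases)
    case (2 i \<sigma>0)
    then show ?case
      using body[OF 2] \<sigma> by (auto simp: I_def same_except_def simp del: wp_simps)
  qed (use \<sigma> bound in \<open>simp_all add: I_def same_except_def total_completions_def\<close>)
qed

section \<open>Deciding the nodes one after another\<close>

text \<open>Node \<open>v\<close> is accepted tentatively, then scored; rejection undoes the change.
  Expectations are compared by cross-multiplication, which avoids division. As \<open>q\<close> is
  already lowered, \<open>s - (q + 1)\<close> is the number of nodes accepted before, hence the next
  free cell of \<open>P\<close>.\<close>

definition decide_node :: com where
  "decide_node =
    Seq (Store ''B'' (Var ''v'') (Const 1)) (Seq (Assign ''q'' (Minus (Var ''q'') (Const 1))) (Seq score
    (Cond (Less (Times (Var ''acc'') (Binom (Var ''n'') (Var ''s'')))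
        (Times (Var ''K'') (Binom (Minus (Var ''n'') (Var ''v'')) (Var ''q''))))
      (Seq (Store ''B'' (Var ''v'') (Const 0)) (Assign ''q'' (Plus (Var ''q'') (Const 1))))
      (Store ''P'' (Minus (Var ''s'') (Plus (Var ''q'') (Const 1))) (Var ''v'')))))"

text \<open>\<open>v\<close> and \<open>B\<close> rely on the default value 0: no node is decided
  and the corrupted set is empty. The test \<open>0 < q\<close> keeps the decrement of
  \<open>q\<close> from truncating.\<close>

definition attack :: com where
  "attack =
    Seq (Assign ''q'' (Var ''s'')) (Seq score (Seq (Assign ''K'' (Var ''acc''))
    (While (Less (Var ''v'') (Var ''n''))
      (Seq (Assign ''v'' (Plus (Var ''v'') (Const 1)))
        (Cond (Less (Const 0) (Var ''q'')) decide_node Skip)))))"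

locale attack_input =
  fixes bt :: "nat \<Rightarrow> nat \<Rightarrow> nat" and n k m r s D :: nat and G :: "nat \<Rightarrow> nat"
  assumes bt: "b \<le> a \<Longrightarrow> a \<le> n \<Longrightarrow> bt a b \<le> D"
    and pos: "1 \<le> n" "1 \<le> k" "1 \<le> m" "1 \<le> D"
    and s_le: "s \<le> n"
    and rows: "i < m \<Longrightarrow> row k G i \<subseteq> {1..n} \<and> card (row k G i) = k"
begin

abbreviation total :: "nat \<Rightarrow> nat \<Rightarrow> nat set \<Rightarrow> nat" where
  "total \<equiv> total_completions n k m r G"

text \<open>
  \<open>K\<close> is the number of pairs for the empty set; the last inequality compares the current
  conditional expectation with the initial one, \<open>K / (n choose s)\<close>.
\<close>

definition partial_attack :: "nat \<Rightarrow> nat \<Rightarrow> nat \<Rightarrow> nat set \<Rightarrow> state \<Rightarrow> bool" where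
  "partial_attack K v q P \<sigma> \<longleftrightarrow>
    scal \<sigma> ''n'' = n \<and> scal \<sigma> ''k'' = k \<and> scal \<sigma> ''m'' = m \<and> scal \<sigma> ''r'' = r \<and>
    scal \<sigma> ''s'' = s \<and> scal \<sigma> ''v'' = v \<and> scal \<sigma> ''q'' = q \<and> scal \<sigma> ''K'' = K \<and>
    arr \<sigma> ''A'' = G \<and> arr \<sigma> ''B'' = (\<lambda>x. of_bool (x \<in> P)) \<and> arr \<sigma> ''P'' ` {..<card P} = P \<and>
    P \<subseteq> {1..v} \<and> v \<le> n \<and> card P + q = s \<and> q \<le> n - v \<and>
    K * ((n - v) choose q) \<le> total v q P * (n choose s)"

text \<open>In \<open>\<sigma>\<close> the node counter is already advanced, so the invariant holds after resetting it.\<close>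

lemma wp_decide_node:
  assumes inv: "partial_attack K v (Suc q) P (set_scal ''v'' v \<sigma>)"
    and v: "v < n" "scal \<sigma> ''v'' = Suc v"
  shows "wp bt decide_node (\<lambda>t \<sigma>'. t \<le> 400 * (k * m * D) + 2 * D + 40 \<and>
    (\<exists>q P. partial_attack K (Suc v) q P \<sigma>')) \<sigma>"
proof -
  let ?P = "insert (Suc v) P"
  define \<sigma>1 where "\<sigma>1 = set_scal ''q'' q (set_arr ''B'' (Suc v) 1 \<sigma>)"
  have \<sigma>: "scal \<sigma> ''n'' = n" "scal \<sigma> ''k'' = k" "scal \<sigma> ''m'' = m" "scal \<sigma> ''r'' = r"
      "scal \<sigma> ''s'' = s" "scal \<sigma> ''q'' = Suc q" "scal \<sigma> ''K'' = K"
      "arr \<sigma> ''A'' = G" "arr \<sigma> ''B'' = (\<lambda>x. of_bool (x \<in> P))" "arr \<sigma> ''P'' ` {..<card P} = P"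
    and P: "P \<subseteq> {1..v}" "card P + Suc q = s" "Suc q \<le> n - v"
    and avg: "K * ((n - v) choose Suc q) \<le> total v (Suc q) P * (n choose s)"
    using inv by (simp_all add: partial_attack_def)
  have "Suc v \<notin> P" "finite P"
    using P(1) finite_subset by auto
  have "s - Suc q = card P"
    using P(2) by simp
  have B: "(\<lambda>x. of_bool (x \<in> P))(Suc v := 1) = (\<lambda>x. of_bool (x \<in> ?P))"
    "(\<lambda>x. of_bool (x \<in> ?P))(Suc v := 0) = (\<lambda>x. of_bool (x \<in> P))"
    using \<open>Suc v \<notin> P\<close> by (auto simp: fun_eq_iff)
  have decide: "wp bt (Cond (Less (Times (Var ''acc'') (Binom (Var ''n'') (Var ''s'')))
        (Times (Var ''K'') (Binom (Minus (Var ''n'') (Var ''v'')) (Var ''q''))))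
      (Seq (Store ''B'' (Var ''v'') (Const 0)) (Assign ''q'' (Plus (Var ''q'') (Const 1))))
      (Store ''P'' (Minus (Var ''s'') (Plus (Var ''q'') (Const 1))) (Var ''v'')))
      (\<lambda>t \<sigma>'. t \<le> 2 * D + 30 \<and> (\<exists>q P. partial_attack K (Suc v) q P \<sigma>')) \<sigma>2"
    if frame: "same_except score_vars \<sigma>1 \<sigma>2" and acc: "scal \<sigma>2 ''acc'' = total (Suc v) q ?P" for \<sigma>2
  proof -
    have \<sigma>2: "scal \<sigma>2 ''n'' = n" "scal \<sigma>2 ''k'' = k" "scal \<sigma>2 ''m'' = m" "scal \<sigma>2 ''r'' = r"
      "scal \<sigma>2 ''s'' = s" "scal \<sigma>2 ''v'' = Suc v" "scal \<sigma>2 ''q'' = q" "scal \<sigma>2 ''K'' = K"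
      "arr \<sigma>2 ''A'' = G" "arr \<sigma>2 ''P'' = arr \<sigma> ''P''"
      using frame by (simp_all add: same_except_def \<sigma>1_def \<sigma> v)
    have B2: "arr \<sigma>2 ''B'' = (\<lambda>x. of_bool (x \<in> ?P))"
      using frame unfolding B(1)[symmetric] by (simp add: same_except_def \<sigma>1_def \<sigma>)
    \<comment> \<open>The invariant \<open>Suc q \<le> n - v\<close> keeps the second pair of
      arguments in the range where \<open>bt\<close> is bounded.\<close>
    have cost: "bt n s \<le> D" "bt (n - Suc v) q \<le> D"
      using s_le P(3) by (auto intro: bt)
    show ?thesis
    \<comment> \<open>If the test succeeds, the node is rejected and \<open>reject_node\<close>
      restores the invariant; if it fails, its negation is the new inequality itself.\<close>
    proof (cases "total (Suc v) q ?P * (n choose s) < K * ((n - Suc v) choose q)")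
      case True
      have "(arr \<sigma>2 ''B'')(Suc v := 0) = (\<lambda>x. of_bool (x \<in> P))"
        unfolding B2 by (rule B(2))
      then have "partial_attack K (Suc v) (Suc q) P (set_scal ''q'' (Suc q) (set_arr ''B'' (Suc v) 0 \<sigma>2))"
        unfolding partial_attack_def
        using reject_node[OF v(1) avg True] P v \<sigma>2 \<sigma>(10) by auto
      then show ?thesis
        using True cost by (auto simp: \<sigma>2 acc)
    next
      case False
      have "{..<card P} \<inter> {x. x \<noteq> card P} = {..<card P}"
        by auto
      then have "(arr \<sigma> ''P'')(card P := Suc v) ` {..<card ?P} = ?P"
        using \<open>Suc v \<notin> P\<close> \<open>finite P\<close> \<sigma>(10) by (simp add: lessThan_Suc fun_upd_image)
      then have "partial_attack K (Suc v) q ?P (set_arr ''P'' (s - Suc q) (Suc v) \<sigma>2)"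
        unfolding partial_attack_def \<open>s - Suc q = card P\<close>
        using False P v \<sigma>2 B2 \<open>Suc v \<notin> P\<close> \<open>finite P\<close> by auto
      then show ?thesis
        using False cost by (auto simp: \<sigma>2 acc)
    qed
  qed
  have score: "wp bt score (\<lambda>t \<sigma>'. t \<le> 400 * (k * m * D) \<and> same_except score_vars \<sigma>1 \<sigma>' \<and>
      scal \<sigma>' ''acc'' = total (Suc v) q ?P) \<sigma>1"
    by (rule wp_score[OF bt pos(2-4) rows])
      (use v P B(1) in \<open>auto simp: \<sigma>1_def \<sigma>\<close>)
  have init: "set_scal ''q'' (aval (Minus (Var ''q'') (Const 1)) (set_arr ''B'' (aval (Var ''v'') \<sigma>)
      (aval (Const 1) \<sigma>) \<sigma>)) (set_arr ''B'' (aval (Var ''v'') \<sigma>) (aval (Const 1) \<sigma>) \<sigma>) = \<sigma>1"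
    by (simp add: \<sigma>1_def \<sigma> v)
  show ?thesis
    unfolding decide_node_def wp_simps(2,3) wp_simps(4)[of bt "Assign _ _"] wp_simps(4)[of bt "Store _ _ _"]
      wp_simps(4)[of bt score] init
  proof (rule wp_mono[OF score], elim conjE, goal_cases)
    case (1 t \<sigma>2)
    show ?case
      by (rule wp_mono[OF decide[OF 1(2,3)]]) (use 1(1) in auto)
  qed
qed

text \<open>One initial scoring and at most one per node, each within
  \<open>400 * (k * m * D)\<close>, dominate the time.\<close>

lemma wp_attack:
  "wp bt attack (\<lambda>t \<sigma>. t \<le> 1000 * (k * m * n * D) \<and>
    output_set s \<sigma> \<subseteq> {1..n} \<and> card (output_set s \<sigma>) = s \<and>
    total 0 s {} \<le> total n 0 (output_set s \<sigma>) * (n choose s)) (input_state n k m r s G)"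
proof -
  let ?\<sigma> = "set_scal ''q'' s (input_state n k m r s G)"
  let ?K = "total 0 s {}"
  define C where "C = 400 * (k * m * D) + 2 * D + 60"
  have input: "scal ?\<sigma> ''n'' = n" "scal ?\<sigma> ''k'' = k" "scal ?\<sigma> ''m'' = m" "scal ?\<sigma> ''r'' = r"
    "scal ?\<sigma> ''s'' = s" "scal ?\<sigma> ''v'' = 0" "scal ?\<sigma> ''q'' = s"
    "arr ?\<sigma> ''A'' = G" "arr ?\<sigma> ''B'' = (\<lambda>x. of_bool (x \<in> {}))"
    by (simp_all add: input_state_def)
  have score: "wp bt score (\<lambda>t \<sigma>. t \<le> 400 * (k * m * D) \<and> same_except score_vars ?\<sigma> \<sigma> \<and>
      scal \<sigma> ''acc'' = ?K) ?\<sigma>"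
    by (rule wp_score[OF bt pos(2-4) rows]) (use input in auto)
  have init: "partial_attack ?K 0 s {} (set_scal ''K'' ?K \<sigma>)" if "same_except score_vars ?\<sigma> \<sigma>" for \<sigma>
    using that input s_le by (simp add: partial_attack_def same_except_def)
  have step: "bval (Less (Var ''v'') (Var ''n'')) \<sigma> \<and>
      bcost bt (Less (Var ''v'') (Var ''n'')) \<sigma> + 1 \<le> 4 \<and>
      wp bt (Seq (Assign ''v'' (Plus (Var ''v'') (Const 1)))
        (Cond (Less (Const 0) (Var ''q'')) decide_node Skip))
      (\<lambda>t \<sigma>'. t \<le> C \<and> (\<exists>q P. partial_attack ?K (Suc v) q P \<sigma>')) \<sigma>"
    if "v < n" "\<exists>q P. partial_attack ?K v q P \<sigma>" for v \<sigma>
  proof -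
    from that(2) obtain q P where inv: "partial_attack ?K v q P \<sigma>"
      by blast
    let ?\<sigma>1 = "set_scal ''v'' (Suc v) \<sigma>"
    have v: "scal \<sigma> ''v'' = v" "scal \<sigma> ''n'' = n" "scal \<sigma> ''q'' = q"
      using inv by (simp_all add: partial_attack_def)
    show ?thesis
    proof (cases q)
      case 0
      \<comment> \<open>With \<open>q = 0\<close> the total does not depend on \<open>v\<close>, and
        both binomial coefficients \<open>choose 0\<close> are 1.\<close>
      have "partial_attack ?K (Suc v) 0 P ?\<sigma>1"
        using inv \<open>v < n\<close> unfolding 0 partial_attack_def total_completions_def num_completions_0
        by auto
      then show ?thesis
        using v \<open>v < n\<close> 0 by (auto simp: C_def)
    next
      case (Suc q')
      have "partial_attack ?K v (Suc q') P (set_scal ''v'' v ?\<sigma>1)"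
        using inv unfolding Suc by (simp add: partial_attack_def)
      note dec = wp_decide_node[OF this \<open>v < n\<close>]
      have "wp bt decide_node (\<lambda>t \<sigma>'. t \<le> 400 * (k * m * D) + 2 * D + 40 \<and>
          (\<exists>q P. partial_attack ?K (Suc v) q P \<sigma>')) ?\<sigma>1"
        by (rule dec) simp
      then show ?thesis
        by (simp add: v \<open>v < n\<close> Suc) (erule wp_mono, simp add: C_def)
    qed
  qed
  have stop: "\<not> bval (Less (Var ''v'') (Var ''n'')) \<sigma> \<and>
      bcost bt (Less (Var ''v'') (Var ''n'')) \<sigma> + 1 \<le> 4"
    if "\<exists>q P. partial_attack ?K n q P \<sigma>" for \<sigma>
    using that by (auto simp: partial_attack_def)
  \<comment> \<open>At \<open>v = n\<close> the bound \<open>q \<le> n - v\<close> forces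
    \<open>q = 0\<close>, so \<open>P\<close> has \<open>s\<close> elements, fills exactly the
    output cells, and the binomial coefficient in the invariant is 1.\<close>
  have result: "output_set s \<sigma> \<subseteq> {1..n} \<and> card (output_set s \<sigma>) = s \<and>
      ?K \<le> total n 0 (output_set s \<sigma>) * (n choose s)"
    if "\<exists>q P. partial_attack ?K n q P \<sigma>" for \<sigma>
    using that by (auto simp: partial_attack_def output_set_def)
  have "1 * 1 * 1 * 1 \<le> k * m * n * D" "k * m * 1 * D \<le> k * m * n * D" "1 * 1 * n * D \<le> k * m * n * D"
    "1 * 1 * n * 1 \<le> k * m * n * D"
    using pos by (intro mult_le_mono; simp)+
  moreover have "n * (C + 4) = 400 * (k * m * n * D) + 2 * (1 * 1 * n * D) + 64 * (1 * 1 * n * 1)"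
    by (simp add: C_def algebra_simps)
  ultimately have bound: "400 * (k * m * D) + (n * (C + 4) + 4) + 10 \<le> 1000 * (k * m * n * D)"
    by linarith
  have loop: "wp bt (Seq (Assign ''K'' (Var ''acc'')) (While (Less (Var ''v'') (Var ''n''))
      (Seq (Assign ''v'' (Plus (Var ''v'') (Const 1)))
        (Cond (Less (Const 0) (Var ''q'')) decide_node Skip))))
      (\<lambda>t \<sigma>'. t \<le> n * (C + 4) + 4 + 2 \<and> output_set s \<sigma>' \<subseteq> {1..n} \<and> card (output_set s \<sigma>') = s \<and>
        ?K \<le> total n 0 (output_set s \<sigma>') * (n choose s)) \<sigma>"
    if "same_except score_vars ?\<sigma> \<sigma>" "scal \<sigma> ''acc'' = ?K" for \<sigma>
    unfolding wp_simps(2) wp_simps(4)[of bt "Assign ''K'' _"]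
  proof (rule wp_mono[OF wp_While[where I = "\<lambda>v \<sigma>. \<exists>q P. partial_attack ?K v q P \<sigma>"
          and N = n and B = C and C = 4]], goal_cases)
    case 1
    show ?case
      using init[OF that(1)] that(2) by auto
  next
    case (2 v \<sigma>')
    then show ?case
      by (rule step)
  next
    case (3 \<sigma>')
    then show ?case
      by (rule stop)
  next
    case (4 t \<sigma>')
    then show ?case
      using result by simp
  qed
  have "wp bt score (\<lambda>t1. wp bt (Seq (Assign ''K'' (Var ''acc'')) (While (Less (Var ''v'') (Var ''n''))
      (Seq (Assign ''v'' (Plus (Var ''v'') (Const 1)))
        (Cond (Less (Const 0) (Var ''q'')) decide_node Skip))))
      (\<lambda>t2 \<sigma>'. 2 + (t1 + t2) \<le> 1000 * (k * m * n * D) \<and> output_set s \<sigma>' \<subseteq> {1..n} \<and>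
        card (output_set s \<sigma>') = s \<and> ?K \<le> total n 0 (output_set s \<sigma>') * (n choose s))) ?\<sigma>"
  proof (rule wp_mono[OF score], elim conjE, goal_cases)
    case (1 t \<sigma>)
    show ?case
      by (rule wp_mono[OF loop[OF 1(2,3)]]) (use 1(1) bound in auto)
  qed
  then show ?thesis
    unfolding attack_def wp_simps(2) wp_simps(4)[of bt score] wp_simps(4)[of bt "Assign ''q'' _"]
    by (simp add: input_state_def)
qed

end

section \<open>Transfer to real time bounds and probabilities\<close>

theorem theorem6:
  fixes T :: "nat \<Rightarrow> real"
    and bt :: "nat \<Rightarrow> nat \<Rightarrow> nat"
  assumes bt_pos: "\<And>a b. 0 < bt a b"
    and bt_le: "\<And>n a b. b \<le> a \<Longrightarrow> a \<le> n \<Longrightarrow> real (bt a b) \<le> T n"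
  shows "\<exists>(prog :: com) (C :: real).
    \<forall>(n :: nat) (k :: nat) (m :: nat) (s :: nat) (r :: nat) (\<mu> :: real) (\<gamma> :: real)
      (\<A> :: nat set multiset) (G :: nat \<Rightarrow> nat).
      1 \<le> k \<longrightarrow> 1 \<le> m \<longrightarrow> 0 < \<gamma> \<longrightarrow> \<gamma> < 1 \<longrightarrow> real s = \<gamma> * real n \<longrightarrow>
      0 \<le> \<mu> \<longrightarrow> r = corruption_threshold \<mu> k \<longrightarrow>
      group_family n k m \<A> \<longrightarrow> encodes_family k m G \<A> \<longrightarrow>
      (\<exists>t \<sigma>. exec bt prog (input_state n k m r s G) t \<sigma> \<and>
         real t \<le> C * (real k * real m * real n * T n) \<and>
         output_set s \<sigma> \<subseteq> {1..n} \<and>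
         card (output_set s \<sigma>) = s \<and>
         kappa n k r \<gamma> * real m \<le> real (size {#A \<in># \<A>. corrupted r (output_set s \<sigma>) A#}))"
\<comment> \<open>Both witnesses are fixed before the input is given.\<close>
proof (rule exI[where x = attack], rule exI[where x = "1000 :: real"], intro allI impI)
  fix n k m s r :: nat and \<mu> \<gamma> :: real and \<A> :: "nat set multiset" and G :: "nat \<Rightarrow> nat"
  assume pos: "1 \<le> k" "1 \<le> m" and \<gamma>: "0 < \<gamma>" "\<gamma> < 1" and s: "real s = \<gamma> * real n"
    and family: "group_family n k m \<A>" and enc: "encodes_family k m G \<A>"
  \<comment> \<open>Step counts are natural numbers, so rounding \<open>T n\<close> down still
    bounds every \<open>bt a b\<close> in range.\<close>
  define D where "D = nat \<lfloor>T n\<rfloor>"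
  have \<A>: "\<A> = image_mset (row k G) (mset_set {..<m})"
    using enc by (simp add: encodes_family_def)
  have rows: "row k G i \<subseteq> {1..n} \<and> card (row k G i) = k" if "i < m" for i
    using family that unfolding \<A> group_family_def by auto
  then have "k \<le> n"
    using rows[of 0] pos card_mono[of "{1..n}" "row k G 0"] by simp
  have bt_D: "bt a b \<le> D" if "b \<le> a" "a \<le> n" for a b
    using bt_le[OF that] unfolding D_def by (simp add: le_nat_floor)
  have "1 \<le> D"
    using bt_D[of 0 0] bt_pos[of 0 0] by simp
  have "real s \<le> 1 * real n"
    unfolding s using \<gamma> by (intro mult_right_mono) auto
  then have "s \<le> n"
    by simp
  interpret attack_input bt n k m r s D G
    using bt_D pos \<open>k \<le> n\<close> \<open>1 \<le> D\<close> \<open>s \<le> n\<close> rows by unfold_locales auto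
  from wp_attack obtain t \<sigma> where run: "exec bt attack (input_state n k m r s G) t \<sigma>"
      "t \<le> 1000 * (k * m * n * D)"
    and out: "output_set s \<sigma> \<subseteq> {1..n}" "card (output_set s \<sigma>) = s"
    and avg: "total 0 s {} \<le> total n 0 (output_set s \<sigma>) * (n choose s)"
    unfolding wp_def by blast
  \<comment> \<open>\<open>nat\<close> would raise a negative floor to 0; \<open>1 \<le> D\<close>
    excludes this.\<close>
  have "real D \<le> T n"
    using \<open>1 \<le> D\<close> unfolding D_def by linarith
  have "real t \<le> 1000 * (real k * real m * real n * real D)"
    using run(2) by (metis of_nat_le_iff of_nat_mult of_nat_numeral)
  also have "\<dots> \<le> 1000 * (real k * real m * real n * T n)"
    using \<open>real D \<le> T n\<close> by (intro mult_left_mono) auto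
  finally have time: "real t \<le> 1000 * (real k * real m * real n * T n)" .
  have "total n 0 P = size {#A \<in># \<A>. corrupted r P A#}" for P
    unfolding total_completions_def num_completions_0 \<A>
    by (simp add: filter_mset_image_mset Int_def)
  moreover have "real (total 0 s {}) = kappa n k r \<gamma> * real m * real (n choose s)"
  proof -
    have "real (num_completions n r 0 s {} (row k G i)) = kappa n k r \<gamma> * real (n choose s)"
      if "i < m" for i
      using kappa_eq_num_completions[OF s \<open>s \<le> n\<close>, of "row k G i" k r] rows[OF that] by simp
    then have "real (total 0 s {}) = (\<Sum>i<m. kappa n k r \<gamma> * real (n choose s))"
      unfolding total_completions_def of_nat_sum by (intro sum.cong) auto
    then show ?thesis
      by simp
  qed
  moreover have "real (total 0 s {}) \<le> real (total n 0 (output_set s \<sigma>)) * real (n choose s)"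
    using avg by (metis of_nat_le_iff of_nat_mult)
  \<comment> \<open>Cancel \<open>n choose s\<close>, which is positive because
    \<open>s \<le> n\<close>.\<close>
  ultimately have "kappa n k r \<gamma> * real m \<le> real (size {#A \<in># \<A>. corrupted r (output_set s \<sigma>) A#})"
    using \<open>s \<le> n\<close> by simp
  with run(1) time out show "\<exists>t \<sigma>. exec bt attack (input_state n k m r s G) t \<sigma> \<and>
      real t \<le> 1000 * (real k * real m * real n * T n) \<and>
      output_set s \<sigma> \<subseteq> {1..n} \<and> card (output_set s \<sigma>) = s \<and>
      kappa n k r \<gamma> * real m \<le> real (size {#A \<in># \<A>. corrupted r (output_set s \<sigma>) A#})"
    by blast
qed

end
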